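(* Let $\mathsf{Val}\in\{\mathsf{Sum},\mathsf{Avg}\}$. A nondeterministic $\mathsf{Val}$ automaton (on finite words) is history deterministic if and only if it is determinizable by pruning.
   Context: For a finite sequence $v=v_0\ldots v_{n-1}$ of rationals, $\mathsf{Sum}(v)=\sum_{i=0}^{n-1}v_i$ and $\mathsf{Avg}(v)=\frac1n\sum_{i=0}^{n-1}v_i$. A nondeterministic quantitative automaton is $\mathcal{A}=(\Sigma,Q,\iota,\delta)$ with finite nonempty alphabet $\Sigma$, finite nonempty state set $Q$, initial state $\iota$, and $\delta:Q\times\Sigma\to 2^{\mathbb{Q}\times Q}$ with finite nonempty values; $(x,q')\in\delta(q,a)$ gives a transition from $q$ to $q'$ over $a$ with weight $x$. It is deterministic if all $\delta(q,a)$ are singletons. A $\mathsf{Val}$ automaton is one equipped with value function $\mathsf{Val}$. A run on a finite word $w$ is a sequence $\pi$ of consecutive transitions from $\iota$ over the letters of $w$; $\mathsf{Val}(\pi)$ is $\mathsf{Val}$ of its weight sequence; $\mathcal{A}(w)$ is the supremum of $\mathsf{Val}(\pi)$ over runs $\pi$ on $w$. Automata are equivalent if they give the same value to each word. **History determinism (nondeterministic case, finite words).** In the letter game on $\mathcal{A}$, starting from $\iota$, in each round Adam picks a letter $a\in\Sigma$ and Eve picks a transition over $a$ from the current state; this produces an infinite word $w$ and an infinite sequence $\pi$ of transitions; Eve wins the play if $\mathsf{Val}(\pi[0..i])\ge\mathcal{A}(w[0..i])$ for all $i$. $\mathcal{A}$ is history deterministic if Eve has a winning strategy (depending on the history of the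 play). **Determinizability by pruning.** $\mathcal{A}$ is determinizable by pruning if there is a deterministic $\mathsf{Val}$ automaton equivalent to $\mathcal{A}$ obtained from $\mathcal{A}$ by removing some states and transitions. *)

theory Defs
  imports Complex_Main
begin

record ('a, 'q) qaut =
  alphabet :: "'a set"
  states :: "'q set"
  init_state :: "'q"
  delta :: "'q \<Rightarrow> 'a \<Rightarrow> (rat \<times> 'q) set"

definition qaut_wf :: "('a, 'q) qaut \<Rightarrow> bool" where
  "qaut_wf A \<longleftrightarrow>
     finite (alphabet A) \<and> alphabet A \<noteq> {} \<and>
     finite (states A) \<and> init_state A \<in> states A \<and>
     (\<forall>q\<in>states A. \<forall>a\<in>alphabet A.
        finite (delta A q a) \<and> delta A q a \<noteq> {} \<and> delta A q a \<subseteq> UNIV \<times> states A)"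

definition deterministic :: "('a, 'q) qaut \<Rightarrow> bool" where
  "deterministic A \<longleftrightarrow> (\<forall>q\<in>states A. \<forall>a\<in>alphabet A. is_singleton (delta A q a))"

definition Sum_val :: "rat list \<Rightarrow> rat" where
  "Sum_val v = (\<Sum>i<length v. v ! i)"

text \<open>On the empty sequence, where the average is undefined, \<open>Avg_val\<close> is \<open>0\<close> by the convention
  for division by zero. The letter game never evaluates it there, and all automata give the empty
  word this same value.\<close>

definition Avg_val :: "rat list \<Rightarrow> rat" where
  "Avg_val v = 1 / of_nat (length v) * (\<Sum>i<length v. v ! i)"

datatype ('a, 'q) trans =
  Trans (source: 'q) (letter: 'a) (weight: rat) (target: 'q)

definition transitions :: "('a, 'q) qaut \<Rightarrow> ('a, 'q) trans set" where
  "transitions A =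
     {Trans q a x q' | q a x q'. q \<in> states A \<and> a \<in> alphabet A \<and> (x, q') \<in> delta A q a}"

fun is_path :: "('a, 'q) qaut \<Rightarrow> 'q \<Rightarrow> ('a, 'q) trans list \<Rightarrow> bool" where
  "is_path A q [] \<longleftrightarrow> True"
| "is_path A q (t # ts) \<longleftrightarrow> t \<in> transitions A \<and> source t = q \<and> is_path A (target t) ts"

definition runs :: "('a, 'q) qaut \<Rightarrow> 'a list \<Rightarrow> ('a, 'q) trans list set" where
  "runs A w = {ts. is_path A (init_state A) ts \<and> map letter ts = w}"

definition run_val :: "(rat list \<Rightarrow> rat) \<Rightarrow> ('a, 'q) trans list \<Rightarrow> real" where
  "run_val Val ts = real_of_rat (Val (map weight ts))"

definition word_val :: "(rat list \<Rightarrow> rat) \<Rightarrow> ('a, 'q) qaut \<Rightarrow> 'a list \<Rightarrow> real" where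
  "word_val Val A w = (SUP ts\<in>runs A w. run_val Val ts)"

definition equivalent ::
  "(rat list \<Rightarrow> rat) \<Rightarrow> ('a, 'q) qaut \<Rightarrow> ('a, 'q) qaut \<Rightarrow> bool" where
  "equivalent Val A B \<longleftrightarrow>
     alphabet A = alphabet B \<and> (\<forall>w\<in>lists (alphabet A). word_val Val A w = word_val Val B w)"

definition current_state :: "('a, 'q) qaut \<Rightarrow> ('a, 'q) trans list \<Rightarrow> 'q" where
  "current_state A ts = (if ts = [] then init_state A else target (last ts))"

text \<open>A strategy of Eve maps the history of the play and Adam's next letter to a transition. Since
  transitions carry their letter, the list of transitions taken so far also records Adam's past
  choices.\<close>

type_synonym ('a, 'q) strategy = "('a, 'q) trans list \<Rightarrow> 'a \<Rightarrow> ('a, 'q) trans"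

definition eve_strategy :: "('a, 'q) qaut \<Rightarrow> ('a, 'q) strategy \<Rightarrow> bool" where
  "eve_strategy A \<sigma> \<longleftrightarrow>
     (\<forall>ts a. is_path A (init_state A) ts \<longrightarrow> a \<in> alphabet A \<longrightarrow>
        \<sigma> ts a \<in> transitions A \<and> source (\<sigma> ts a) = current_state A ts \<and> letter (\<sigma> ts a) = a)"

definition prefix_of :: "(nat \<Rightarrow> 'b) \<Rightarrow> nat \<Rightarrow> 'b list" where
  "prefix_of f n = map f [0..<n]"

definition is_play ::
  "('a, 'q) qaut \<Rightarrow> (nat \<Rightarrow> 'a) \<Rightarrow> (nat \<Rightarrow> ('a, 'q) trans) \<Rightarrow> bool" where
  "is_play A w \<pi> \<longleftrightarrow>
     (\<forall>i. w i \<in> alphabet A \<and> \<pi> i \<in> transitions A \<and> letter (\<pi> i) = w i \<and>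
          source (\<pi> i) = current_state A (prefix_of \<pi> i))"

definition consistent ::
  "('a, 'q) strategy \<Rightarrow> (nat \<Rightarrow> 'a) \<Rightarrow> (nat \<Rightarrow> ('a, 'q) trans) \<Rightarrow> bool" where
  "consistent \<sigma> w \<pi> \<longleftrightarrow> (\<forall>i. \<pi> i = \<sigma> (prefix_of \<pi> i) (w i))"

definition eve_wins ::
  "(rat list \<Rightarrow> rat) \<Rightarrow> ('a, 'q) qaut \<Rightarrow> (nat \<Rightarrow> 'a) \<Rightarrow> (nat \<Rightarrow> ('a, 'q) trans) \<Rightarrow> bool" where
  "eve_wins Val A w \<pi> \<longleftrightarrow>
     (\<forall>i. run_val Val (prefix_of \<pi> (Suc i)) \<ge> word_val Val A (prefix_of w (Suc i)))"

definition history_deterministic :: "(rat list \<Rightarrow> rat) \<Rightarrow> ('a, 'q) qaut \<Rightarrow> bool" where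
  "history_deterministic Val A \<longleftrightarrow>
     (\<exists>\<sigma>. eve_strategy A \<sigma> \<and>
        (\<forall>w \<pi>. is_play A w \<pi> \<longrightarrow> consistent \<sigma> w \<pi> \<longrightarrow> eve_wins Val A w \<pi>))"

definition pruning_of :: "('a, 'q) qaut \<Rightarrow> ('a, 'q) qaut \<Rightarrow> bool" where
  "pruning_of B A \<longleftrightarrow>
     qaut_wf B \<and> alphabet B = alphabet A \<and> states B \<subseteq> states A \<and>
     init_state B = init_state A \<and>
     (\<forall>q\<in>states B. \<forall>a\<in>alphabet B. delta B q a \<subseteq> delta A q a)"

definition determinizable_by_pruning :: "(rat list \<Rightarrow> rat) \<Rightarrow> ('a, 'q) qaut \<Rightarrow> bool" where
  "determinizable_by_pruning Val A \<longleftrightarrow>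
     (\<exists>B. pruning_of B A \<and> deterministic B \<and> equivalent Val B A)"

end

theory Submission
  imports Defs
begin

text \<open>A transition that a winning strategy of Eve takes from a state \<open>q\<close> must be at least as good as
  every alternative for every future word: otherwise Adam would play that word. The history cancels
  out of this comparison, since sums are additive and averages compare like sums on words of equal
  length. Hence Eve may commit, for each state she reaches, to the choices her strategy makes after
  one fixed history leading to it, and these choices form a deterministic pruning. Conversely, an
  equivalent deterministic pruning is a strategy of Eve.\<close>

section \<open>Paths and runs\<close>

lemma is_path_append:
  "is_path A q (xs @ ys) \<longleftrightarrow>
     is_path A q xs \<and> is_path A (if xs = [] then q else target (last xs)) ys"
  by (induction xs arbitrary: q) auto

lemma is_path_init_append:
  "is_path A (init_state A) (xs @ ys) \<longleftrightarrow>
     is_path A (init_state A) xs \<and> is_path A (current_state A xs) ys"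
  by (simp add: is_path_append current_state_def)

lemma is_path_transitions: "is_path A q ts \<Longrightarrow> set ts \<subseteq> transitions A"
  by (induction ts arbitrary: q) auto

lemma letter_transitions: "t \<in> transitions A \<Longrightarrow> letter t \<in> alphabet A"
  by (auto simp: transitions_def)

lemma target_transitions: "qaut_wf A \<Longrightarrow> t \<in> transitions A \<Longrightarrow> target t \<in> states A"
  by (fastforce simp: transitions_def qaut_wf_def)

lemma letters_path: "is_path A q ts \<Longrightarrow> map letter ts \<in> lists (alphabet A)"
  using is_path_transitions[of A q ts] letter_transitions[of _ A] by (auto simp: subset_iff)

lemma current_state_snoc [simp]: "current_state A (ts @ [t]) = target t"
  by (simp add: current_state_def)

lemma current_state_in_states:
  assumes "qaut_wf A" "is_path A (init_state A) ts"
  shows "current_state A ts \<in> states A"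
proof (cases ts rule: rev_cases)
  case Nil
  then show ?thesis using assms by (simp add: current_state_def qaut_wf_def)
next
  case (snoc us t)
  then show ?thesis
    using assms target_transitions by (fastforce simp: is_path_init_append)
qed

text \<open>The transition set is a finite union of images of the finite sets
  \<open>delta A q a\<close>. This makes the runs on a fixed word finite in number, so that the real
  supremum in \<open>word_val\<close> is bounded.\<close>

lemma finite_transitions:
  assumes "qaut_wf A"
  shows "finite (transitions A)"
proof -
  have "transitions A =
      (\<Union>q\<in>states A. \<Union>a\<in>alphabet A. (\<lambda>(x, q'). Trans q a x q') ` delta A q a)"
    by (auto simp: transitions_def image_iff)
  then show ?thesis using assms by (auto simp: qaut_wf_def)
qed

lemma finite_runs:
  assumes "qaut_wf A"
  shows "finite (runs A w)"
proof (rule finite_subset)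
  show "runs A w \<subseteq> {ts. set ts \<subseteq> transitions A \<and> length ts = length w}"
    using is_path_transitions by (fastforce simp: runs_def)
  show "finite {ts. set ts \<subseteq> transitions A \<and> length ts = length w}"
    by (intro finite_lists_length_eq finite_transitions assms)
qed

lemma path_exists:
  assumes "qaut_wf A" "q \<in> states A" "w \<in> lists (alphabet A)"
  shows "\<exists>ts. is_path A q ts \<and> map letter ts = w"
  using assms(3,2)
proof (induction w arbitrary: q)
  case (Cons a w)
  then obtain x q' where "(x, q') \<in> delta A q a" "q' \<in> states A"
    using assms(1) by (fastforce simp: qaut_wf_def)
  moreover from this(2) obtain ts where "is_path A q' ts" "map letter ts = w"
    using Cons.IH by blast
  ultimately show ?case
    using Cons by (intro exI[of _ "Trans q a x q' # ts"]) (auto simp: transitions_def)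
qed auto

lemma deterministic_path_unique:
  assumes "deterministic A" "is_path A q ts" "is_path A q us" "map letter ts = map letter us"
  shows "ts = us"
  using assms(2-)
proof (induction ts arbitrary: q us)
  case (Cons t ts)
  from Cons.prems obtain u vs where us: "us = u # vs" by (cases us) auto
  have "(weight t, target t) \<in> delta A q (letter t)" "(weight u, target u) \<in> delta A q (letter t)"
    and "q \<in> states A" "letter t \<in> alphabet A" "source t = source u" "letter t = letter u"
    using Cons.prems by (auto simp: us transitions_def)
  with assms(1) have "weight t = weight u \<and> target t = target u"
    by (metis deterministic_def is_singletonE prod.inject singletonD)
  then have "t = u"
    using \<open>source t = source u\<close> \<open>letter t = letter u\<close> by (intro trans.expand) simp
  then show ?case using Cons us by auto
qed auto

lemma transitions_mono:
  assumes "pruning_of B A"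
  shows "transitions B \<subseteq> transitions A"
  using assms by (fastforce simp: pruning_of_def transitions_def)

lemma is_path_mono:
  assumes "transitions B \<subseteq> transitions A" "is_path B q ts"
  shows "is_path A q ts"
  using assms(2,1) by (induction ts arbitrary: q) auto

section \<open>Comparing runs by total weight\<close>

text \<open>A common yardstick for sums and averages. Being additive over concatenation, it lets a
  shared prefix be cancelled.\<close>

definition total :: "('a, 'q) trans list \<Rightarrow> rat" where
  "total ts = sum_list (map weight ts)"

lemma total_simps [simp]:
  "total [] = 0" "total (t # ts) = weight t + total ts" "total (ts @ us) = total ts + total us"
  by (simp_all add: total_def)

text \<open>An average over n > 0 entries is the sum scaled by the positive factor 1/n, which is the
  same on both sides. If one run is empty, so is the other.\<close>

lemma run_val_le_iff:
  fixes ts us :: "('a, 'q) trans list"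
  assumes "Val \<in> {Sum_val, Avg_val}" "length ts = length us"
  shows "run_val Val ts \<le> run_val Val us \<longleftrightarrow> total ts \<le> total us"
proof -
  have s: "(\<Sum>i<length vs. vs ! i) = sum_list vs" for vs :: "rat list"
    by (simp add: sum_list_sum_nth atLeast0LessThan)
  show ?thesis
  proof (cases "ts = []")
    case False
    then have "0 < (of_nat (length us) :: rat)" using assms(2) by (cases us) auto
    then show ?thesis
      using assms unfolding run_val_def total_def Sum_val_def Avg_val_def s
      by (auto simp: of_rat_less_eq divide_le_cancel)
  qed (use assms in auto)
qed

lemma word_val_eq_run_val:
  assumes "ts \<in> runs A w" "\<And>us. us \<in> runs A w \<Longrightarrow> run_val Val us \<le> run_val Val ts"
  shows "word_val Val A w = run_val Val ts"
  unfolding word_val_def using assms by (intro cSup_eq_maximum) auto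

lemma run_val_le_word_val:
  assumes "qaut_wf A" "ts \<in> runs A w"
  shows "run_val Val ts \<le> word_val Val A w"
  unfolding word_val_def
  using assms by (intro cSUP_upper bdd_above_finite finite_imageI finite_runs)

section \<open>Plays\<close>

text \<open>The finite play that \<sigma> produces when Adam spells w. Folding from the left gives
  \<sigma> at each letter exactly the history built so far.\<close>

definition response :: "('a, 'q) strategy \<Rightarrow> 'a list \<Rightarrow> ('a, 'q) trans list" where
  "response \<sigma> w = foldl (\<lambda>ts a. ts @ [\<sigma> ts a]) [] w"

lemma response_simps [simp]:
  "response \<sigma> [] = []" "response \<sigma> (w @ [a]) = response \<sigma> w @ [\<sigma> (response \<sigma> w) a]"
  by (simp_all add: response_def)

lemma response_append: "\<exists>us. response \<sigma> (v @ w) = response \<sigma> v @ us"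
proof (induction w rule: rev_induct)
  case (snoc a w)
  then show ?case using response_simps(2)[of \<sigma> "v @ w" a] by auto
qed simp

lemma response_in_runs:
  assumes "eve_strategy A \<sigma>" "w \<in> lists (alphabet A)"
  shows "response \<sigma> w \<in> runs A w"
  using assms(2)
proof (induction w rule: rev_induct)
  case (snoc a w)
  then have "is_path A (init_state A) (response \<sigma> w)" "map letter (response \<sigma> w) = w"
    by (auto simp: runs_def)
  moreover have "a \<in> alphabet A" using snoc.prems by auto
  ultimately show ?case
    using assms(1) by (simp add: runs_def is_path_init_append eve_strategy_def)
qed (simp add: runs_def)

lemma prefix_of_Suc [simp]: "prefix_of f (Suc n) = prefix_of f n @ [f n]"
  by (simp add: prefix_of_def)

lemma consistent_prefix_of:
  assumes "consistent \<sigma> w \<pi>"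
  shows "prefix_of \<pi> n = response \<sigma> (prefix_of w n)"
proof (induction n)
  case (Suc n)
  have "\<pi> n = \<sigma> (prefix_of \<pi> n) (w n)" using assms by (simp add: consistent_def)
  then show ?case using Suc by simp
qed (simp add: prefix_of_def)

lemma prefix_of_in_lists: "(\<And>i. w i \<in> S) \<Longrightarrow> prefix_of w n \<in> lists S"
  by (auto simp: prefix_of_def)

text \<open>Winning speaks only of infinite plays, so v is prolonged to an infinite word. The play
  of \<sigma> on that word begins with \<open>response \<sigma> v\<close>, and the winning condition
  after the last letter of v bounds every run on v.\<close>

lemma winning_response_maximal:
  assumes val: "Val \<in> {Sum_val, Avg_val}" and wf: "qaut_wf A" and \<sigma>: "eve_strategy A \<sigma>"
    and win: "\<forall>w \<pi>. is_play A w \<pi> \<longrightarrow> consistent \<sigma> w \<pi> \<longrightarrow> eve_wins Val A w \<pi>"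
    and r: "ts \<in> runs A v"
  shows "total ts \<le> total (response \<sigma> v)"
proof (cases v rule: rev_cases)
  case Nil
  then show ?thesis using r by (simp add: runs_def)
next
  case (snoc v' b)
  have v: "v \<in> lists (alphabet A)" using r letters_path[of A "init_state A" ts] by (simp add: runs_def)
  then have b: "b \<in> alphabet A" using snoc by auto
  \<comment> \<open>The last letter b of v is repeated forever; it serves as padding because it is
    known to lie in the alphabet.\<close>
  define w where "w i = (if i < length v then v ! i else b)" for i
  define \<pi> where "\<pi> i = \<sigma> (response \<sigma> (prefix_of w i)) (w i)" for i
  have w: "w i \<in> alphabet A" for i
    using v b by (auto simp: w_def in_lists_conv_set)
  have pw: "prefix_of w (length v) = v"
    unfolding prefix_of_def w_def by (rule nth_equalityI) auto
  have p\<pi>: "prefix_of \<pi> n = response \<sigma> (prefix_of w n)" for n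
    by (induction n) (simp_all add: prefix_of_def[of _ 0] \<pi>_def)
  have cons: "consistent \<sigma> w \<pi>"
    by (simp add: consistent_def p\<pi>) (simp add: \<pi>_def)
  have "is_path A (init_state A) (response \<sigma> (prefix_of w i))" for i
    using response_in_runs[OF \<sigma> prefix_of_in_lists[of w, OF w]] by (simp add: runs_def)
  then have "is_play A w \<pi>"
    using \<sigma> w unfolding is_play_def eve_strategy_def p\<pi> by (simp add: \<pi>_def)
  then have "eve_wins Val A w \<pi>" using cons win by blast
  \<comment> \<open>Round i is judged on the prefix of length \<open>Suc i\<close>, so v is judged
    in round \<open>length v'\<close>. The empty word is never judged and was treated
    separately.\<close>
  then have "word_val Val A (prefix_of w (Suc (length v'))) \<le>
      run_val Val (prefix_of \<pi> (Suc (length v')))"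
    by (simp only: eve_wins_def)
  moreover have "Suc (length v') = length v" using snoc by simp
  ultimately have "word_val Val A v \<le> run_val Val (response \<sigma> v)"
    by (simp only: p\<pi> pw)
  with run_val_le_word_val[OF wf r] have "run_val Val ts \<le> run_val Val (response \<sigma> v)"
    by (rule order_trans)
  moreover have "length ts = length (response \<sigma> v)"
    using r response_in_runs[OF \<sigma> v] by (auto simp: runs_def dest!: map_eq_imp_length_eq)
  ultimately show ?thesis using run_val_le_iff[OF val] by blast
qed

section \<open>History determinism and pruning\<close>

lemma history_deterministic_imp_prunable:
  assumes val: "Val \<in> {Sum_val, Avg_val}" and wf: "qaut_wf A"
    and hd: "history_deterministic Val A"
  shows "determinizable_by_pruning Val A"
proof -
  obtain \<sigma> where \<sigma>: "eve_strategy A \<sigma>"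
    and win: "\<forall>w \<pi>. is_play A w \<pi> \<longrightarrow> consistent \<sigma> w \<pi> \<longrightarrow> eve_wins Val A w \<pi>"
    using hd by (auto simp: history_deterministic_def)
  note maximal = winning_response_maximal[OF val wf \<sigma> win]
  define L where "L = lists (alphabet A)"
  \<comment> \<open>The states that plays following \<sigma> can reach; \<open>u\<close> then fixes
    one word leading to each of them.\<close>
  define S where "S = (\<lambda>u. current_state A (response \<sigma> u)) ` L"
  have "\<forall>q\<in>S. \<exists>u. u \<in> L \<and> current_state A (response \<sigma> u) = q"
    by (auto simp: S_def)
  then obtain u where u: "\<And>q. q \<in> S \<Longrightarrow> u q \<in> L"
    "\<And>q. q \<in> S \<Longrightarrow> current_state A (response \<sigma> (u q)) = q"
    by metis
  \<comment> \<open>\<sigma> may choose differently after other histories ending in q; the choice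
    after \<open>u q\<close> is the one kept.\<close>
  define T where "T q a = \<sigma> (response \<sigma> (u q)) a" for q a
  define B where "B = \<lparr>alphabet = alphabet A, states = S, init_state = init_state A,
    delta = (\<lambda>q a. {(weight (T q a), target (T q a))})\<rparr>"
  have B [simp]: "alphabet B = alphabet A" "states B = S" "init_state B = init_state A"
    "delta B q a = {(weight (T q a), target (T q a))}" for q a
    by (simp_all add: B_def)
  have path: "is_path A (init_state A) (response \<sigma> v)" "map letter (response \<sigma> v) = v"
    if "v \<in> L" for v
    using response_in_runs[OF \<sigma>] that by (auto simp: runs_def L_def)
  have T: "T q a \<in> transitions A" "source (T q a) = q" "letter (T q a) = a"
    if "q \<in> S" "a \<in> alphabet A" for q a
    using \<sigma> path[OF u(1)] u(2) that by (auto simp: eve_strategy_def T_def)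
  have TS: "target (T q a) \<in> S" if "q \<in> S" "a \<in> alphabet A" for q a
  proof -
    \<comment> \<open>The word \<open>u q @ [a]\<close> witnesses that the target is reached,
      although \<open>u\<close> may have selected another word for it.\<close>
    have "target (T q a) = current_state A (response \<sigma> (u q @ [a]))"
      by (simp add: T_def)
    moreover have "u q @ [a] \<in> L" using u(1) that by (auto simp: L_def)
    ultimately show ?thesis by (simp only: S_def image_eqI)
  qed
  have TA: "(weight (T q a), target (T q a)) \<in> delta A q a"
    if "q \<in> S" "a \<in> alphabet A" for q a
    using T[OF that] by (auto simp: transitions_def)
  have SA: "S \<subseteq> states A"
    using current_state_in_states[OF wf path(1)] by (auto simp: S_def)
  have init: "init_state A \<in> S"
    unfolding S_def by (rule image_eqI[of _ _ "[]"]) (simp_all add: L_def current_state_def)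
  have wfB: "qaut_wf B"
    using wf TS init SA by (auto simp: qaut_wf_def intro: finite_subset)
  have pr: "pruning_of B A"
    using wfB SA TA by (auto simp: pruning_of_def)
  have det: "deterministic B" by (simp add: deterministic_def)
  \<comment> \<open>Induction on b with q and p arbitrary: the continuation chosen by \<sigma> will
    take the place of p in the induction hypothesis.\<close>
  have dominates: "total p \<le> total b"
    if "is_path B q b" "q \<in> S" "is_path A q p" "map letter p = map letter b" for q b p
    using that
  proof (induction b arbitrary: q p)
    case (Cons t b)
    define a w where "a = letter t" and "w = map letter b"
    from Cons.prems have tq: "t \<in> transitions B" "source t = q" by auto
    then have a: "a \<in> alphabet A" using letter_transitions[of t B] by (simp add: a_def)
    have t: "t = T q a"
      using tq T(2,3)[OF \<open>q \<in> S\<close> a] by (auto simp: transitions_def a_def intro: trans.expand)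
    have w: "w \<in> L"
      using Cons.prems(1) letters_path[of B "target t" b] by (simp add: L_def w_def)
    let ?h = "response \<sigma> (u q)"
    have uL: "u q @ a # w \<in> L" using u(1) \<open>q \<in> S\<close> a w by (auto simp: L_def)
    \<comment> \<open>On \<open>u q @ a # w\<close>, \<sigma> first reaches q, then takes the same
      transition t as B, and continues with some r.\<close>
    have "response \<sigma> (u q @ [a]) = ?h @ [t]" by (simp add: t T_def)
    with response_append[of \<sigma> "u q @ [a]" w] obtain r
      where r: "response \<sigma> (u q @ a # w) = ?h @ t # r" by auto
    have hu: "is_path A (init_state A) ?h" "map letter ?h = u q"
      using path u(1) \<open>q \<in> S\<close> by auto
    \<comment> \<open>Since \<open>?h\<close> ends in q, it can be continued by p as well.
      Maximality of the response then compares p with \<open>t # r\<close>, the total of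
      \<open>?h\<close> cancelling.\<close>
    have "?h @ p \<in> runs A (u q @ a # w)"
      using Cons.prems hu u(2) by (auto simp: runs_def is_path_init_append a_def w_def)
    from maximal[OF this] have "total p \<le> weight t + total r" by (simp add: r)
    moreover have "is_path A (target t) r" "map letter r = w"
      using path[OF uL] hu(2) unfolding r by (simp_all add: is_path_init_append)
    moreover have "target t \<in> S" using TS[OF \<open>q \<in> S\<close> a] unfolding t .
    \<comment> \<open>From \<open>target t\<close> on, r may differ from b, since B plays there as
      after the word chosen by \<open>u\<close>. But r is a path of A over w, hence a legitimate
      competitor in the induction hypothesis.\<close>
    ultimately have "total p \<le> weight t + total r" "total r \<le> total b"
      using Cons.IH[of "target t" r] Cons.prems(1) by (simp_all add: w_def)
    then show ?case by simp
  qed simp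
  have "word_val Val B w = word_val Val A w" if w: "w \<in> L" for w
  proof -
    obtain b where b: "b \<in> runs B w"
      using path_exists[OF wfB, of "init_state A" w] init w by (auto simp: runs_def L_def)
    have sub: "runs B w \<subseteq> runs A w"
      using is_path_mono[OF transitions_mono[OF pr]] by (auto simp: runs_def)
    have max: "run_val Val p \<le> run_val Val b" if p: "p \<in> runs A w" for p
    proof -
      have eq: "map letter p = map letter b" using p b by (simp add: runs_def)
      have "total p \<le> total b"
        using b p by (intro dominates[OF _ init _ eq]) (simp_all add: runs_def)
      then show ?thesis
        using run_val_le_iff[OF val map_eq_imp_length_eq[OF eq]] by blast
    qed
    have "word_val Val B w = run_val Val b"
      using b sub max by (intro word_val_eq_run_val) auto
    moreover have "word_val Val A w = run_val Val b"
      using b sub max by (intro word_val_eq_run_val) auto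
    ultimately show ?thesis by simp
  qed
  then have "equivalent Val B A" by (simp add: equivalent_def L_def)
  then show ?thesis using pr det by (auto simp: determinizable_by_pruning_def)
qed

lemma prunable_imp_history_deterministic:
  assumes wf: "qaut_wf A" and dp: "determinizable_by_pruning Val A"
  shows "history_deterministic Val A"
proof -
  obtain B where pr: "pruning_of B A" and det: "deterministic B" and eq: "equivalent Val B A"
    using dp by (auto simp: determinizable_by_pruning_def)
  have wfB: "qaut_wf B" and B: "alphabet B = alphabet A" "init_state B = init_state A"
    using pr by (auto simp: pruning_of_def)
  \<comment> \<open>A strategy must answer every history of A, including those that leave B. Outside
    the states of B any legal transition is allowed; inside, the transition must belong to
    B.\<close>
  define good where "good q a t \<longleftrightarrow> t \<in> transitions A \<and> source t = q \<and> letter t = a \<and>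
      (q \<in> states B \<longrightarrow> t \<in> transitions B)" for q a t
  have ex: "\<exists>t. good q a t" if "q \<in> states A" "a \<in> alphabet A" for q a
  proof (cases "q \<in> states B")
    case True
    then have "\<exists>ts. is_path B q ts \<and> map letter ts = [a]"
      using path_exists[OF wfB, of q "[a]"] that B by simp
    then obtain t where t: "t \<in> transitions B" "source t = q" "letter t = a"
      by auto
    moreover have "t \<in> transitions A"
      using t(1) transitions_mono[OF pr] by blast
    ultimately show ?thesis by (auto simp: good_def)
  next
    case False
    have "\<exists>ts. is_path A q ts \<and> map letter ts = [a]"
      using path_exists[OF wf, of q "[a]"] that by simp
    then show ?thesis using False by (auto simp: good_def)
  qed
  define \<sigma> where "\<sigma> ts a = (SOME t. good (current_state A ts) a t)" for ts a
  have good: "good (current_state A ts) a (\<sigma> ts a)"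
    if "is_path A (init_state A) ts" "a \<in> alphabet A" for ts a
    unfolding \<sigma>_def using ex[OF current_state_in_states[OF wf that(1)] that(2)] by (rule someI_ex)
  have \<sigma>: "eve_strategy A \<sigma>"
    using good by (simp add: eve_strategy_def good_def)
  have cs: "current_state B ts = current_state A ts" for ts
    using B(2) by (simp add: current_state_def)
  \<comment> \<open>Plays following \<sigma> start in B and never leave it, so the arbitrary choices
    outside B do not affect them.\<close>
  have in_B: "is_path B (init_state B) (response \<sigma> w)" if "w \<in> lists (alphabet A)" for w
    using that
  proof (induction w rule: rev_induct)
    case (snoc a w)
    then have a: "a \<in> alphabet A" and p: "is_path B (init_state B) (response \<sigma> w)" by auto
    have "is_path A (init_state A) (response \<sigma> w)"
      using is_path_mono[OF transitions_mono[OF pr] p] B(2) by simp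
    from good[OF this a] current_state_in_states[OF wfB p] p show ?case
      by (simp add: is_path_init_append cs good_def)
  qed simp
  have "eve_wins Val A w \<pi>" if play: "is_play A w \<pi>" and cons: "consistent \<sigma> w \<pi>" for w \<pi>
    unfolding eve_wins_def
  proof
    fix i
    let ?v = "prefix_of w (Suc i)" and ?p = "prefix_of \<pi> (Suc i)"
    have v: "?v \<in> lists (alphabet A)"
      using play by (intro prefix_of_in_lists) (simp add: is_play_def)
    have p: "?p = response \<sigma> ?v" by (rule consistent_prefix_of[OF cons])
    have run: "?p \<in> runs B ?v"
      using in_B[OF v] response_in_runs[OF \<sigma> v] unfolding p by (simp add: runs_def)
    \<comment> \<open>The play so far is the only run of B on its word, so its value is the supremum
      for B, and equivalence carries this to A.\<close>
    have "us = ?p" if "us \<in> runs B ?v" for us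
      using deterministic_path_unique[OF det, of "init_state B" us ?p] that run
      by (simp add: runs_def)
    then have "word_val Val B ?v = run_val Val ?p"
      by (intro word_val_eq_run_val[OF run]) (metis order_refl)
    then show "word_val Val A ?v \<le> run_val Val ?p"
      using eq v B(1) by (simp add: equivalent_def)
  qed
  then show ?thesis using \<sigma> by (auto simp: history_deterministic_def)
qed

theorem theorem21:
  fixes A :: "('a, 'q) qaut" and Val :: "rat list \<Rightarrow> rat"
  assumes "Val \<in> {Sum_val, Avg_val}"
    and "qaut_wf A"
  shows "history_deterministic Val A \<longleftrightarrow> determinizable_by_pruning Val A"
  using assms history_deterministic_imp_prunable prunable_imp_history_deterministic by blast

end
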